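(* Let $r\ge 2$ be a fixed integer and let $m=m(n)$ satisfy $n\ge m$ and $m/\log n\to\infty$ as $n\to\infty$. Then \[ \kappa_{r,2}(m,n) \sim \left(1-\frac{1}{r}\right)m \qquad (n\to\infty). \]
   Context: $K_{m,n}$ denotes the complete bipartite graph with vertex classes $[m]$ and $[n]$. An $r$-edge-coloring is a map $c:E(K_{m,n})\to[r]$ (not all colors need be used). A path is alternating if any two adjacent (consecutive) edges of it have different colors; the length of a path is its number of edges. Paths between two vertices are internally disjoint if they share no vertices other than their endpoints. $\kappa_{r,2k}(m,n)$ is the maximum $t$ such that there is an $r$-edge-coloring of $K_{m,n}$ in which every pair of distinct vertices of the class $[n]$ is connected by $t$ internally disjoint alternating paths of length $2k$. $f\sim g$ means $f/g\to1$ as $n\to\infty$; $\log$ is the natural logarithm. *)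

theory Defs
  imports Complex_Main "HOL-Library.FuncSet" "HOL-Library.Landau_Symbols"
begin

text \<open>
  \<^term>\<open>Inl i\<close> is the vertex \<open>i\<close> of the class \<open>[m]\<close>, \<^term>\<open>Inr j\<close> the vertex \<open>j\<close> of
  the class \<open>[n]\<close>; an edge is the set of its two endpoints.
\<close>

type_synonym vert = "nat + nat"

definition class_m :: "nat \<Rightarrow> vert set" where
  "class_m m = Inl ` {1..m}"

definition class_n :: "nat \<Rightarrow> vert set" where
  "class_n n = Inr ` {1..n}"

definition K_edges :: "nat \<Rightarrow> nat \<Rightarrow> vert set set" where
  "K_edges m n = {{x, y} | x y. x \<in> class_m m \<and> y \<in> class_n n}"

definition edge_coloring :: "nat \<Rightarrow> nat \<Rightarrow> nat \<Rightarrow> (vert set \<Rightarrow> nat) \<Rightarrow> bool" where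
  "edge_coloring r m n c \<longleftrightarrow> c \<in> K_edges m n \<rightarrow> {1..r}"

definition path_between :: "nat \<Rightarrow> nat \<Rightarrow> vert \<Rightarrow> vert \<Rightarrow> vert list \<Rightarrow> bool" where
  "path_between m n u v p \<longleftrightarrow>
     p \<noteq> [] \<and> hd p = u \<and> last p = v \<and> distinct p \<and> set p \<subseteq> class_m m \<union> class_n n \<and>
     (\<forall>i. Suc i < length p \<longrightarrow> {p ! i, p ! Suc i} \<in> K_edges m n)"

definition path_length :: "vert list \<Rightarrow> nat" where
  "path_length p = length p - 1"

definition alternating :: "(vert set \<Rightarrow> nat) \<Rightarrow> vert list \<Rightarrow> bool" where
  "alternating c p \<longleftrightarrow>
     (\<forall>i. Suc (Suc i) < length p \<longrightarrow>
        c {p ! i, p ! Suc i} \<noteq> c {p ! Suc i, p ! Suc (Suc i)})"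

definition internally_disjoint :: "vert \<Rightarrow> vert \<Rightarrow> vert list set \<Rightarrow> bool" where
  "internally_disjoint u v P \<longleftrightarrow>
     (\<forall>p\<in>P. \<forall>q\<in>P. p \<noteq> q \<longrightarrow> set p \<inter> set q \<subseteq> {u, v})"

definition alt_connected ::
  "nat \<Rightarrow> nat \<Rightarrow> (vert set \<Rightarrow> nat) \<Rightarrow> nat \<Rightarrow> nat \<Rightarrow> vert \<Rightarrow> vert \<Rightarrow> bool" where
  "alt_connected m n c l t u v \<longleftrightarrow>
     (\<exists>P. finite P \<and> card P = t \<and> internally_disjoint u v P \<and>
        (\<forall>p\<in>P. path_between m n u v p \<and> path_length p = l \<and> alternating c p))"

text \<open>
  In \<open>kappa r l m n\<close> the second argument is the path length itself, so that \<open>\<kappa>\<^bsub>r,2k\<^esub>(m,n)\<close> is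
  \<open>kappa r (2 * k) m n\<close>. The maximum exists for \<open>r \<ge> 1\<close> and \<open>n \<ge> 2\<close>; for \<open>n \<le> 1\<close> there is no
  pair of distinct vertices in \<open>[n]\<close>, every \<open>t\<close> qualifies, and the value is unspecified.
\<close>

definition kappa :: "nat \<Rightarrow> nat \<Rightarrow> nat \<Rightarrow> nat \<Rightarrow> nat" where
  "kappa r l m n =
     Max {t. \<exists>c. edge_coloring r m n c \<and>
               (\<forall>u\<in>class_n n. \<forall>v\<in>class_n n. u \<noteq> v \<longrightarrow> alt_connected m n c l t u v)}"

end

theory Submission
  imports Defs "HOL-Analysis.Convex"
begin

text \<open>
  Alternating paths of length 2 between \<open>u, v \<in> [n]\<close> correspond to the \<open>i \<in> [m]\<close> at which the
  words \<open>(c(i,u))\<^sub>i\<close> and \<open>(c(i,v))\<^sub>i\<close> over the alphabet \<open>[r]\<close> differ, so \<open>\<kappa>\<^bsub>r,2\<^esub>(m,n)\<close> is the largest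
  minimum Hamming distance of a code of \<open>n\<close> words of length \<open>m\<close>. Averaging the distance over
  all pairs gives the upper bound \<open>(1 - 1/r) m n/(n-1)\<close> (Plotkin). For the lower bound words are
  chosen greedily (Gilbert--Varshamov): an exponential moment estimate shows that a proportion of
  at most \<open>exp (-\<epsilon>\<^sup>2 m/2)\<close> of all words agrees with a given word in more than \<open>(1/r + \<epsilon>) m\<close> places,
  and \<open>n exp (-\<epsilon>\<^sup>2 m/2) < 1\<close> eventually since \<open>m/log n \<rightarrow> \<infinity>\<close>.
\<close>

section \<open>Alternating paths of length 2 and Hamming distance\<close>

definition distinguishing :: "(vert set \<Rightarrow> nat) \<Rightarrow> nat \<Rightarrow> nat \<Rightarrow> nat \<Rightarrow> nat set" where
  "distinguishing c m u v = {i\<in>{1..m}. c {Inl i, Inr u} \<noteq> c {Inl i, Inr v}}"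

lemma finite_distinguishing [simp]: "finite (distinguishing c m u v)"
  by (simp add: distinguishing_def)

lemma Inl_Inr_in_K_edges_iff:
  "{Inl i, Inr u} \<in> K_edges m n \<longleftrightarrow> i \<in> {1..m} \<and> u \<in> {1..n}"
proof
  assume "i \<in> {1..m} \<and> u \<in> {1..n}"
  then show "{Inl i, Inr u} \<in> K_edges m n"
    unfolding K_edges_def class_m_def class_n_def by blast
qed (auto simp: K_edges_def class_m_def class_n_def doubleton_eq_iff)

lemma Inr_Inr_notin_K_edges: "{Inr u, Inr v} \<notin> K_edges m n"
  by (auto simp: K_edges_def class_m_def class_n_def doubleton_eq_iff)

text \<open>A path of length 2 is determined by its middle vertex, which lies in \<open>[m]\<close>
  by bipartiteness. Alternation says that this vertex is distinguishing, and different middle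
  vertices give internally disjoint paths.\<close>

lemma alt_connected_2_iff:
  assumes "u \<in> {1..n}" "v \<in> {1..n}" "u \<noteq> v"
  shows "alt_connected m n c 2 t (Inr u) (Inr v) \<longleftrightarrow> t \<le> card (distinguishing c m u v)"
proof
  assume "alt_connected m n c 2 t (Inr u) (Inr v)"
  then obtain P where P: "card P = t"
    "\<And>p. p \<in> P \<Longrightarrow> path_between m n (Inr u) (Inr v) p \<and> path_length p = 2 \<and> alternating c p"
    unfolding alt_connected_def by blast
  have "P \<subseteq> (\<lambda>i. [Inr u, Inl i, Inr v]) ` distinguishing c m u v"
  proof
    fix p assume "p \<in> P"
    then have p: "path_between m n (Inr u) (Inr v) p" "length p = 3" "alternating c p"
      using P(2)[of p] by (auto simp: path_length_def)
    obtain a x b where "p = [a, x, b]"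
      using p(2) by (auto simp: numeral_3_eq_3 length_Suc_conv)
    with p(1) have px: "p = [Inr u, x, Inr v]"
      by (auto simp: path_between_def)
    have edge: "{Inr u, x} \<in> K_edges m n"
      using p(1) px by (force simp: path_between_def)
    then obtain i where i: "x = Inl i"
      by (cases x) (auto simp: Inr_Inr_notin_K_edges)
    have "i \<in> {1..m}"
      using edge i Inl_Inr_in_K_edges_iff by (simp add: insert_commute)
    moreover have "c {Inr u, Inl i} \<noteq> c {Inl i, Inr v}"
      using p(3) px i by (force simp: alternating_def)
    ultimately have "i \<in> distinguishing c m u v"
      by (simp add: distinguishing_def insert_commute)
    then show "p \<in> (\<lambda>i. [Inr u, Inl i, Inr v]) ` distinguishing c m u v"
      using px i by blast
  qed
  then have "card P \<le> card (distinguishing c m u v)"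
    by (meson card_image_le card_mono finite_distinguishing finite_imageI order_trans)
  then show "t \<le> card (distinguishing c m u v)"
    using P(1) by simp
next
  assume "t \<le> card (distinguishing c m u v)"
  \<comment> \<open>\<open>alt_connected\<close> asks for exactly \<open>t\<close> paths, so exactly
    \<open>t\<close> of the available middle vertices are selected.\<close>
  then obtain I where I: "I \<subseteq> distinguishing c m u v" "card I = t" "finite I"
    by (meson obtain_subset_with_card_n)
  let ?path = "\<lambda>i. [Inr u, Inl i, Inr v] :: vert list"
  have "path_between m n (Inr u) (Inr v) (?path i) \<and> path_length (?path i) = 2 \<and>
      alternating c (?path i)" if "i \<in> I" for i
  proof -
    have i: "i \<in> {1..m}" "c {Inl i, Inr u} \<noteq> c {Inl i, Inr v}"
      using that I(1) by (auto simp: distinguishing_def)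
    then show ?thesis
      using assms Inl_Inr_in_K_edges_iff[of i u m n] Inl_Inr_in_K_edges_iff[of i v m n]
      by (auto simp: path_between_def path_length_def alternating_def class_m_def class_n_def
          insert_commute less_Suc_eq)
  qed
  moreover have "card (?path ` I) = t"
    using I by (subst card_image) (auto simp: inj_on_def)
  moreover have "internally_disjoint (Inr u) (Inr v) (?path ` I)"
    by (auto simp: internally_disjoint_def)
  ultimately show "alt_connected m n c 2 t (Inr u) (Inr v)"
    using I(3) unfolding alt_connected_def by (intro exI[of _ "?path ` I"]) auto
qed

lemma kappa_2_eq:
  "kappa r 2 m n = Max {t. \<exists>c. edge_coloring r m n c \<and>
     (\<forall>u\<in>{1..n}. \<forall>v\<in>{1..n}. u \<noteq> v \<longrightarrow> t \<le> card (distinguishing c m u v))}"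
  unfolding kappa_def class_n_def
  by (intro arg_cong[of _ _ Max] Collect_cong ex_cong1 conj_cong refl)
    (auto simp: alt_connected_2_iff)

section \<open>Plotkin's upper bound\<close>

text \<open>The ordered pairs with equal values number the sum of the squared fibre sizes of
  \<open>g\<close>, which is at least \<open>(card A)\<^sup>2 / card B\<close> by Cauchy-Schwarz. In
  the application \<open>g\<close> sends \<open>u\<close> to the color of its edge to a fixed
  \<open>i\<close>.\<close>

lemma sum_unequal_pairs_le:
  fixes g :: "'a \<Rightarrow> 'b"
  assumes "finite A" "finite B" "B \<noteq> {}" "g \<in> A \<rightarrow> B"
  shows "(\<Sum>u\<in>A. \<Sum>v\<in>A. of_bool (g u \<noteq> g v)) \<le> (1 - 1 / real (card B)) * (real (card A))\<^sup>2"
proof -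
  define a where "a s = (\<Sum>u\<in>A. of_bool (g u = s) :: real)" for s
  \<comment> \<open>Splitting by the common value \<open>s\<close> makes the indicator a sum of
    products, so that summing over \<open>u\<close> and \<open>v\<close> yields the squares of the
    fibre sizes \<open>a s\<close>.\<close>
  have eq: "of_bool (g u = g v) = (\<Sum>s\<in>B. of_bool (g u = s) * of_bool (g v = s) :: real)"
    if "u \<in> A" "v \<in> A" for u v
  proof -
    have "(\<Sum>s\<in>B. of_bool (g u = s) * of_bool (g v = s) :: real)
        = (\<Sum>s\<in>B. if s = g u then of_bool (g v = g u) else 0)"
      by (intro sum.cong) auto
    also have "\<dots> = of_bool (g u = g v)"
      using assms that by (auto simp: Pi_iff)
    finally show ?thesis by simp
  qed
  have "(\<Sum>u\<in>A. \<Sum>v\<in>A. of_bool (g u = g v) :: real)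
      = (\<Sum>u\<in>A. \<Sum>v\<in>A. \<Sum>s\<in>B. of_bool (g u = s) * of_bool (g v = s))"
    by (intro sum.cong refl eq)
  also have "\<dots> = (\<Sum>u\<in>A. \<Sum>s\<in>B. \<Sum>v\<in>A. of_bool (g u = s) * of_bool (g v = s))"
    by (intro sum.cong refl sum.swap)
  also have "\<dots> = (\<Sum>s\<in>B. \<Sum>u\<in>A. \<Sum>v\<in>A. of_bool (g u = s) * of_bool (g v = s))"
    by (rule sum.swap)
  also have "\<dots> = (\<Sum>s\<in>B. (a s)\<^sup>2)"
    by (simp only: a_def power2_eq_square sum_product)
  finally have agree: "(\<Sum>u\<in>A. \<Sum>v\<in>A. of_bool (g u = g v) :: real) = (\<Sum>s\<in>B. (a s)\<^sup>2)" .
  have "(\<Sum>s\<in>B. a s) = (\<Sum>u\<in>A. \<Sum>s\<in>B. of_bool (g u = s))"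
    unfolding a_def by (rule sum.swap)
  also have "\<dots> = (\<Sum>u\<in>A. 1)"
  proof (intro sum.cong refl)
    fix u assume "u \<in> A"
    then have "{s. g u = s} \<inter> B = {g u}" "B \<inter> {s. g u = s} = {g u}"
      using assms(4) by auto
    then show "(\<Sum>s\<in>B. of_bool (g u = s) :: real) = 1"
      using assms(2) by simp
  qed
  finally have "(\<Sum>s\<in>B. a s) = real (card A)"
    by simp
  then have "(real (card A))\<^sup>2 \<le> (\<Sum>s\<in>B. (a s)\<^sup>2) * card B"
    using sum_squared_le_sum_of_squares[of a B] by simp
  moreover have "card B > 0"
    using assms by (simp add: card_gt_0_iff)
  ultimately have le: "(real (card A))\<^sup>2 / card B \<le> (\<Sum>s\<in>B. (a s)\<^sup>2)"
    by (simp add: divide_simps)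
  have "(\<Sum>u\<in>A. \<Sum>v\<in>A. of_bool (g u \<noteq> g v) :: real)
      = (\<Sum>u\<in>A. \<Sum>v\<in>A. 1 - of_bool (g u = g v))"
    by (intro sum.cong) auto
  also have "\<dots> = (real (card A))\<^sup>2 - (\<Sum>s\<in>B. (a s)\<^sup>2)"
    by (simp only: sum_subtractf agree) (simp add: power2_eq_square)
  finally show ?thesis
    using le by (simp add: algebra_simps)
qed

text \<open>Double counting of the distances over all ordered pairs: the diagonal contributes 0 and
  each of the other \<open>n * (n - 1)\<close> pairs at least \<open>t\<close>, while each of the
  \<open>m\<close> coordinates contributes at most \<open>(1 - 1 / r) * n\<^sup>2\<close>.\<close>

lemma min_distance_upper_bound:
  assumes "r \<ge> 1" "n \<ge> 2" and col: "edge_coloring r m n c"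
    and t: "\<And>u v. u \<in> {1..n} \<Longrightarrow> v \<in> {1..n} \<Longrightarrow> u \<noteq> v \<Longrightarrow> t \<le> card (distinguishing c m u v)"
  shows "real t \<le> (1 - 1 / real r) * real m * (real n / (real n - 1))"
proof -
  let ?N = "{1..n}"
  let ?d = "\<lambda>i u v. of_bool (c {Inl i, Inr u} \<noteq> c {Inl i, Inr v}) :: real"
  have card_eq: "real (card (distinguishing c m u v)) = (\<Sum>i\<in>{1..m}. ?d i u v)" for u v
    by (simp add: distinguishing_def Int_def)
  have "(\<Sum>v\<in>?N. if u = v then 0 else real t) = real t * (real n - 1)" if "u \<in> ?N" for u
  proof -
    have "(\<Sum>v\<in>?N. if u = v then 0 else real t) = (\<Sum>v\<in>?N - {u}. real t)"
      using that by (intro sum.mono_neutral_cong_right) auto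
    also have "\<dots> = real t * (real n - 1)"
      using that assms(2) by (simp add: of_nat_diff)
    finally show ?thesis .
  qed
  then have "real n * (real t * (real n - 1)) = (\<Sum>u\<in>?N. \<Sum>v\<in>?N. if u = v then 0 else real t)"
    by simp
  also have "\<dots> \<le> (\<Sum>u\<in>?N. \<Sum>v\<in>?N. \<Sum>i\<in>{1..m}. ?d i u v)"
    using t by (intro sum_mono) (simp only: flip: card_eq, simp)
  \<comment> \<open>Moving the sum over \<open>i\<close> outermost allows the pair count to be
    bounded one coordinate at a time.\<close>
  also have "\<dots> = (\<Sum>u\<in>?N. \<Sum>i\<in>{1..m}. \<Sum>v\<in>?N. ?d i u v)"
    by (intro sum.cong refl sum.swap)
  also have "\<dots> = (\<Sum>i\<in>{1..m}. \<Sum>u\<in>?N. \<Sum>v\<in>?N. ?d i u v)"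
    by (rule sum.swap)
  also have "\<dots> \<le> (\<Sum>i\<in>{1..m}. (1 - 1 / real (card {1..r})) * (real (card ?N))\<^sup>2)"
  proof (intro sum_mono sum_unequal_pairs_le)
    fix i assume "i \<in> {1..m}"
    then show "(\<lambda>u. c {Inl i, Inr u}) \<in> ?N \<rightarrow> {1..r}"
      using col by (auto simp: edge_coloring_def Pi_iff Inl_Inr_in_K_edges_iff simp del: atLeastAtMost_iff)
  qed (use assms in auto)
  finally have "real n * (real t * (real n - 1)) \<le> real n * ((1 - 1 / real r) * real m * real n)"
    by (simp add: power2_eq_square mult_ac)
  then have "real t * (real n - 1) \<le> (1 - 1 / real r) * real m * real n"
    using assms(2) by (subst (asm) mult_le_cancel_left_pos) auto
  then show ?thesis
    using assms(2) by (simp add: pos_le_divide_eq)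
qed

section \<open>Exponential moments and greedy codes\<close>

text \<open>Length minus Hamming distance; words are far apart when this is small, so only its upper
  tail has to be controlled.\<close>

definition agreement :: "'a set \<Rightarrow> ('a \<Rightarrow> 'b) \<Rightarrow> ('a \<Rightarrow> 'b) \<Rightarrow> nat" where
  "agreement A w w' = card {i\<in>A. w i = w' i}"

lemma agreement_commute: "agreement A w w' = agreement A w' w"
  by (simp add: agreement_def eq_commute)

text \<open>Markov's inequality for \<open>exp (\<epsilon> * agreement)\<close> under the counting measure on words.\<close>

lemma card_large_agreement_le:
  fixes \<epsilon> :: real
  assumes "finite A" "finite B" "card B \<ge> 2" "w \<in> A \<rightarrow> B" "0 < \<epsilon>" "\<epsilon> \<le> 1"
  shows "real (card {w' \<in> A \<rightarrow>\<^sub>E B. real (agreement A w w') > (1 / real (card B) + \<epsilon>) * real (card A)})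
    \<le> real (card B) ^ card A * exp (- (\<epsilon>\<^sup>2 * real (card A) / 2))"
proof -
  define q where "q = real (card B)"
  define M where "M = real (card A)"
  define S where "S = {w' \<in> A \<rightarrow>\<^sub>E B. real (agreement A w w') > (1 / q + \<epsilon>) * M}"
  have q: "q \<ge> 2"
    using assms(3) by (simp add: q_def)
  have fin: "finite (A \<rightarrow>\<^sub>E B)"
    using assms by (intro finite_PiE)
  have moment: "exp (\<epsilon> * real (agreement A w w')) = (\<Prod>i\<in>A. exp (\<epsilon> * of_bool (w i = w' i)))" for w'
    using assms(1) by (simp add: agreement_def Int_def flip: exp_sum sum_distrib_left)
  have factor: "(\<Sum>b\<in>B. exp (\<epsilon> * of_bool (w i = b))) = q + (exp \<epsilon> - 1)" if "i \<in> A" for i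
  proof -
    have "(\<Sum>b\<in>B. exp (\<epsilon> * of_bool (w i = b))) = (\<Sum>b\<in>B. 1 + (if b = w i then exp \<epsilon> - 1 else 0))"
      by (intro sum.cong) auto
    also have "\<dots> = q + (exp \<epsilon> - 1)"
      using assms that by (auto simp: q_def sum.distrib Pi_iff)
    finally show ?thesis .
  qed
  \<comment> \<open>For \<open>0 < \<epsilon> \<le> 1\<close>,
    \<open>exp \<epsilon> \<le> 1 + \<epsilon> + \<epsilon>\<^sup>2\<close>; then
    \<open>1 + y \<le> exp y\<close> puts the factor of one coordinate into exponential
    form.\<close>
  have "q + (exp \<epsilon> - 1) \<le> q + (\<epsilon> + \<epsilon>\<^sup>2)"
    using exp_bound[of \<epsilon>] assms by simp
  also have "\<dots> = q * (1 + (\<epsilon> + \<epsilon>\<^sup>2) / q)"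
    using q by (simp add: field_simps)
  also have "\<dots> \<le> q * exp ((\<epsilon> + \<epsilon>\<^sup>2) / q)"
    using q by (intro mult_left_mono exp_ge_add_one_self) auto
  finally have base: "q + (exp \<epsilon> - 1) \<le> q * exp ((\<epsilon> + \<epsilon>\<^sup>2) / q)" .

  \<comment> \<open>Markov's step: every word in \<open>S\<close> has at least this exponential
    weight, and the total weight of all words factors over the coordinates.\<close>
  have "real (card S) * exp (\<epsilon> * ((1 / q + \<epsilon>) * M)) = (\<Sum>w'\<in>S. exp (\<epsilon> * ((1 / q + \<epsilon>) * M)))"
    by simp
  also have "\<dots> \<le> (\<Sum>w'\<in>S. exp (\<epsilon> * real (agreement A w w')))"
    using assms by (intro sum_mono) (auto simp: S_def)
  also have "\<dots> \<le> (\<Sum>w'\<in>A \<rightarrow>\<^sub>E B. exp (\<epsilon> * real (agreement A w w')))"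
    using fin by (intro sum_mono2) (auto simp: S_def)
  also have "\<dots> = (\<Prod>i\<in>A. \<Sum>b\<in>B. exp (\<epsilon> * of_bool (w i = b)))"
    using assms by (simp only: moment) (intro prod_sum_PiE [symmetric], auto)
  also have "\<dots> = (q + (exp \<epsilon> - 1)) ^ card A"
    by (simp add: factor)
  also have "\<dots> \<le> (q * exp ((\<epsilon> + \<epsilon>\<^sup>2) / q)) ^ card A"
    using q assms by (intro power_mono base) auto
  also have "\<dots> = q ^ card A * exp ((\<epsilon> + \<epsilon>\<^sup>2) / q * M)"
    by (simp add: power_mult_distrib M_def mult.commute flip: exp_of_nat_mult)
  finally have "real (card S) \<le> q ^ card A * exp ((\<epsilon> + \<epsilon>\<^sup>2) / q * M) / exp (\<epsilon> * ((1 / q + \<epsilon>) * M))"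
    by (simp add: pos_le_divide_eq)
  also have "\<dots> = q ^ card A * exp ((\<epsilon> + \<epsilon>\<^sup>2) / q * M - \<epsilon> * ((1 / q + \<epsilon>) * M))"
    by (simp add: exp_diff)
  \<comment> \<open>Taking the excess \<open>\<epsilon>\<close> also as the parameter of the moment
    leaves only quadratic terms: the two terms \<open>\<epsilon> * M / q\<close> cancel. Then
    \<open>q \<ge> 2\<close> gives the constant 1/2.\<close>
  also have "(\<epsilon> + \<epsilon>\<^sup>2) / q * M - \<epsilon> * ((1 / q + \<epsilon>) * M) = (1 / q - 1) * (\<epsilon>\<^sup>2 * M)"
    using q by (simp add: field_simps power2_eq_square)
  also have "q ^ card A * exp ((1 / q - 1) * (\<epsilon>\<^sup>2 * M)) \<le> q ^ card A * exp (- 1 / 2 * (\<epsilon>\<^sup>2 * M))"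
  proof -
    have "1 / q - 1 \<le> - 1 / 2"
      using q by (simp add: field_simps)
    then have "(1 / q - 1) * (\<epsilon>\<^sup>2 * M) \<le> - 1 / 2 * (\<epsilon>\<^sup>2 * M)"
      by (intro mult_right_mono) (auto simp: M_def)
    then show ?thesis
      using q by (intro mult_left_mono) auto
  qed
  finally show ?thesis
    by (simp add: S_def q_def M_def)
qed

text \<open>Each word already chosen excludes at most a proportion
  \<open>exp (- (\<epsilon>\<^sup>2 * card A / 2))\<close> of all words. By \<open>small\<close>,
  fewer than \<open>n\<close> such exclusions cannot exhaust the space, so a further word can be
  added.\<close>

lemma exists_code_small_agreement:
  fixes \<epsilon> :: real
  assumes "finite A" "finite B" "card B \<ge> 2" "0 < \<epsilon>" "\<epsilon> \<le> 1"
    and small: "real n * exp (- (\<epsilon>\<^sup>2 * real (card A) / 2)) < 1"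
  shows "\<exists>W :: nat \<Rightarrow> 'a \<Rightarrow> 'b. (\<forall>u\<in>{1..n}. W u \<in> A \<rightarrow>\<^sub>E B) \<and>
    (\<forall>u\<in>{1..n}. \<forall>v\<in>{1..n}. u \<noteq> v \<longrightarrow>
      real (agreement A (W u) (W v)) \<le> (1 / real (card B) + \<epsilon>) * real (card A))"
proof -
  define L where "L = (1 / real (card B) + \<epsilon>) * real (card A)"
  define x where "x = exp (- (\<epsilon>\<^sup>2 * real (card A) / 2))"
  define Q where "Q = real (card B) ^ card A"
  have "Q > 0"
    using assms(3) by (simp add: Q_def)
  have "\<exists>W :: nat \<Rightarrow> 'a \<Rightarrow> 'b. (\<forall>u\<in>{1..k}. W u \<in> A \<rightarrow>\<^sub>E B) \<and>
    (\<forall>u\<in>{1..k}. \<forall>v\<in>{1..k}. u \<noteq> v \<longrightarrow> real (agreement A (W u) (W v)) \<le> L)" if "k \<le> n" for k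
    using that
  proof (induction k)
    case 0
    then show ?case by simp
  next
    case (Suc k)
    obtain W :: "nat \<Rightarrow> 'a \<Rightarrow> 'b" where W: "\<And>u. u \<in> {1..k} \<Longrightarrow> W u \<in> A \<rightarrow>\<^sub>E B"
      "\<And>u v. u \<in> {1..k} \<Longrightarrow> v \<in> {1..k} \<Longrightarrow> u \<noteq> v \<Longrightarrow> real (agreement A (W u) (W v)) \<le> L"
      using Suc.IH[OF Suc_leD[OF Suc.prems]] by blast
    define S where "S u = {w' \<in> A \<rightarrow>\<^sub>E B. real (agreement A (W u) w') > L}" for u
    \<comment> \<open>Union bound over the excluded sets \<open>S u\<close>; strictness of
      \<open>small\<close> leaves at least one word outside.\<close>
    have "real (card (\<Union>u\<in>{1..k}. S u)) \<le> real (\<Sum>u\<in>{1..k}. card (S u))"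
      using card_UN_le[of "{1..k}" S] by (simp only: of_nat_le_iff finite_atLeastAtMost)
    also have "\<dots> \<le> (\<Sum>u\<in>{1..k}. Q * x)"
      unfolding of_nat_sum S_def L_def Q_def x_def
      using W(1) assms by (intro sum_mono card_large_agreement_le) (auto simp: PiE_def)
    also have "\<dots> = Q * (real k * x)"
      by simp
    also have "\<dots> \<le> Q * (real n * x)"
      using Suc.prems \<open>Q > 0\<close> by (intro mult_left_mono mult_right_mono) (auto simp: x_def)
    also have "\<dots> < Q * 1"
      using small \<open>Q > 0\<close> unfolding x_def by (intro mult_strict_left_mono)
    also have "Q * 1 = real (card (A \<rightarrow>\<^sub>E B))"
      using assms(1) by (simp add: Q_def card_PiE)
    finally have less: "card (\<Union>u\<in>{1..k}. S u) < card (A \<rightarrow>\<^sub>E B)"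
      by simp
    have "\<not> (A \<rightarrow>\<^sub>E B) \<subseteq> (\<Union>u\<in>{1..k}. S u)"
    proof
      assume sub: "(A \<rightarrow>\<^sub>E B) \<subseteq> (\<Union>u\<in>{1..k}. S u)"
      have "finite (A \<rightarrow>\<^sub>E B)"
        using assms by (intro finite_PiE)
      then have "finite (\<Union>u\<in>{1..k}. S u)"
        by (auto simp: S_def)
      then show False
        using card_mono[OF _ sub] less by simp
    qed
    then obtain w where w: "w \<in> A \<rightarrow>\<^sub>E B" "\<And>u. u \<in> {1..k} \<Longrightarrow> real (agreement A (W u) w) \<le> L"
      by (force simp: S_def)
    \<comment> \<open>The condition ranges over ordered pairs, so the new word is also needed in the
      first argument.\<close>
    have w': "real (agreement A w (W u)) \<le> L" if "u \<in> {1..k}" for u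
      using w(2)[OF that] by (simp only: agreement_commute[of A w])
    have ins: "{1..Suc k} = insert (Suc k) {1..k}" "\<And>u. u \<in> {1..k} \<Longrightarrow> u \<noteq> Suc k"
      by auto
    show ?case
      unfolding ins(1)
      using W w w' ins(2)
      by (intro exI[of _ "W(Suc k := w)"]) (simp del: atLeastAtMost_iff One_nat_def)
  qed
  from this[of n] show ?thesis
    by (simp add: L_def)
qed

text \<open>A code is read as a coloring: the word of \<open>u\<close> lists the colors of the edges
  at \<open>u\<close>.\<close>

lemma exists_coloring_large_distance:
  fixes \<epsilon> :: real
  assumes "r \<ge> 2" "0 < \<epsilon>" "\<epsilon> \<le> 1" "real n * exp (- (\<epsilon>\<^sup>2 * real m / 2)) < 1"
  shows "\<exists>c. edge_coloring r m n c \<and>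
    (\<forall>u\<in>{1..n}. \<forall>v\<in>{1..n}. u \<noteq> v \<longrightarrow>
      (1 - 1 / real r - \<epsilon>) * real m \<le> real (card (distinguishing c m u v)))"
proof -
  have card: "card {1..k} = k" for k :: nat
    by simp
  obtain W :: "nat \<Rightarrow> nat \<Rightarrow> nat" where W: "\<forall>u\<in>{1..n}. W u \<in> {1..m} \<rightarrow>\<^sub>E {1..r}"
    "\<forall>u\<in>{1..n}. \<forall>v\<in>{1..n}. u \<noteq> v \<longrightarrow>
      real (agreement {1..m} (W u) (W v)) \<le> (1 / real r + \<epsilon>) * real m"
    using exists_code_small_agreement[of "{1..m}" "{1..r}" \<epsilon> n, unfolded card,
      OF finite_atLeastAtMost finite_atLeastAtMost assms]
    by (elim exE conjE) (rule that)
  \<comment> \<open>Edges are unordered sets, but the tags \<open>Inl\<close> and \<open>Inr\<close>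
    make both endpoints uniquely recoverable.\<close>
  define c :: "vert set \<Rightarrow> nat" where "c e = W (THE u. Inr u \<in> e) (THE i. Inl i \<in> e)" for e
  have c: "c {Inl i, Inr u} = W u i" for i u
    by (simp add: c_def)
  have "edge_coloring r m n c"
    unfolding edge_coloring_def
  proof
    fix e assume "e \<in> K_edges m n"
    then obtain i u where e: "e = {Inl i, Inr u}" "i \<in> {1..m}" "u \<in> {1..n}"
      unfolding K_edges_def class_m_def class_n_def by blast
    show "c e \<in> {1..r}"
      unfolding e(1) c by (rule PiE_mem[OF bspec[OF W(1) e(3)] e(2)])
  qed
  moreover have "(1 - 1 / real r - \<epsilon>) * real m \<le> real (card (distinguishing c m u v))"
    if "u \<in> {1..n}" "v \<in> {1..n}" "u \<noteq> v" for u v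
  proof -
    have "distinguishing c m u v = {1..m} - {i\<in>{1..m}. W u i = W v i}"
      unfolding distinguishing_def c by blast
    also have "card \<dots> = card {1..m} - agreement {1..m} (W u) (W v)"
      unfolding agreement_def by (rule card_Diff_subset) auto
    finally have "card (distinguishing c m u v) = m - agreement {1..m} (W u) (W v)"
      by (simp only: card)
    \<comment> \<open>Truncation of the natural subtraction could only enlarge the left-hand
      side.\<close>
    then have "real (card (distinguishing c m u v)) \<ge> real m - real (agreement {1..m} (W u) (W v))"
      by linarith
    moreover have "real (agreement {1..m} (W u) (W v)) \<le> (1 / real r + \<epsilon>) * real m"
      using W(2) that by blast
    ultimately show ?thesis
      by (simp add: algebra_simps)
  qed
  ultimately show ?thesis by blast
qed

section \<open>Bounds for \<open>kappa\<close> and the limit\<close>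

text \<open>\<open>Max\<close> is meaningful here: Plotkin's bound makes the set of admissible
  values finite, and a constant coloring shows that it contains 0. For \<open>n \<ge> 2\<close>
  there are pairs to which the bound applies.\<close>

lemma
  assumes "r \<ge> 1" "n \<ge> 2"
  shows kappa_2_upper: "real (kappa r 2 m n) \<le> (1 - 1 / real r) * real m * (real n / (real n - 1))"
    and kappa_2_ge: "\<And>c t. edge_coloring r m n c \<Longrightarrow>
      (\<And>u v. u \<in> {1..n} \<Longrightarrow> v \<in> {1..n} \<Longrightarrow> u \<noteq> v \<Longrightarrow> t \<le> card (distinguishing c m u v)) \<Longrightarrow>
      t \<le> kappa r 2 m n"
proof -
  define T where "T = {t. \<exists>c. edge_coloring r m n c \<and>
     (\<forall>u\<in>{1..n}. \<forall>v\<in>{1..n}. u \<noteq> v \<longrightarrow> t \<le> card (distinguishing c m u v))}"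
  have \<kappa>: "kappa r 2 m n = Max T"
    by (simp only: kappa_2_eq T_def)
  have upper: "real t \<le> (1 - 1 / real r) * real m * (real n / (real n - 1))" if "t \<in> T" for t
    using that min_distance_upper_bound[OF assms] unfolding T_def by blast
  then have "T \<subseteq> {..nat \<lfloor>(1 - 1 / real r) * real m * (real n / (real n - 1))\<rfloor>}"
    by (auto simp: le_nat_floor)
  then have fin: "finite T"
    using finite_subset by blast
  have "edge_coloring r m n (\<lambda>_. 1)"
    using assms by (simp add: edge_coloring_def)
  then have "0 \<in> T"
    unfolding T_def by blast
  then have "Max T \<in> T"
    using fin by (intro Max_in) auto
  then show "real (kappa r 2 m n) \<le> (1 - 1 / real r) * real m * (real n / (real n - 1))"
    using upper \<kappa> by simp
  show "t \<le> kappa r 2 m n" if "edge_coloring r m n c"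
    "\<And>u v. u \<in> {1..n} \<Longrightarrow> v \<in> {1..n} \<Longrightarrow> u \<noteq> v \<Longrightarrow> t \<le> card (distinguishing c m u v)" for c t
  proof -
    have "t \<in> T"
      using that unfolding T_def by blast
    then show ?thesis
      using fin \<kappa> by simp
  qed
qed

lemma kappa_2_lower:
  fixes \<epsilon> :: real
  assumes "r \<ge> 2" "n \<ge> 2" "0 < \<epsilon>" "\<epsilon> \<le> 1" "real n * exp (- (\<epsilon>\<^sup>2 * real m / 2)) < 1"
  shows "(1 - 1 / real r - \<epsilon>) * real m \<le> real (kappa r 2 m n)"
proof -
  obtain c where c: "edge_coloring r m n c"
    "\<And>u v. u \<in> {1..n} \<Longrightarrow> v \<in> {1..n} \<Longrightarrow> u \<noteq> v \<Longrightarrow>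
      (1 - 1 / real r - \<epsilon>) * real m \<le> real (card (distinguishing c m u v))"
    using exists_coloring_large_distance[of r \<epsilon> n m] assms by blast
  \<comment> \<open>Distances are natural numbers, so the real lower bound may be rounded up; a
    negative bound becomes 0.\<close>
  have "nat \<lceil>(1 - 1 / real r - \<epsilon>) * real m\<rceil> \<le> kappa r 2 m n"
    using assms c by (intro kappa_2_ge[OF _ _ c(1)]) (auto simp: nat_le_iff ceiling_le_iff)
  then show ?thesis
    by linarith
qed

theorem theorem2p1:
  fixes r :: nat and m :: "nat \<Rightarrow> nat"
  assumes "r \<ge> 2"
    and "\<And>n. n \<ge> 1 \<Longrightarrow> m n \<le> n"
    and "filterlim (\<lambda>n. real (m n) / ln (real n)) at_top sequentially"
  shows "asymp_equiv (\<lambda>n. real (kappa r 2 (m n) n)) sequentially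
           (\<lambda>n. (1 - 1 / real r) * real (m n))"
proof (rule asymp_equivI'_const)
  let ?\<rho> = "1 - 1 / real r"
  \<comment> \<open>A nonzero limit of the quotient by \<open>m n\<close> is what yields asymptotic
    equivalence to \<open>?\<rho> * m n\<close>.\<close>
  show "?\<rho> \<noteq> 0"
    using assms(1) by simp
  have large: "eventually (\<lambda>n. n \<ge> 2 \<and> real (m n) > K * ln (real n)) sequentially" for K
    using eventually_ge_at_top[of 2] filterlim_at_top_dense[THEN iffD1, OF assms(3), rule_format, of K]
  proof eventually_elim
    case (elim n)
    then show ?case
      by (simp add: pos_less_divide_eq)
  qed
  show "((\<lambda>n. real (kappa r 2 (m n) n) / real (m n)) \<longlongrightarrow> ?\<rho>) sequentially"
  proof (rule order_tendstoI)
    fix a assume "a < ?\<rho>"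
    \<comment> \<open>Half the gap keeps \<open>a < ?\<rho> - \<epsilon>\<close> strict; the cap at
      1 is for the exponential estimate.\<close>
    define \<epsilon> where "\<epsilon> = min 1 ((?\<rho> - a) / 2)"
    have \<epsilon>: "0 < \<epsilon>" "\<epsilon> \<le> 1" "a < ?\<rho> - \<epsilon>"
      using \<open>a < ?\<rho>\<close> unfolding \<epsilon>_def by (auto simp: min_def field_simps)
    show "eventually (\<lambda>n. a < real (kappa r 2 (m n) n) / real (m n)) sequentially"
      \<comment> \<open>This \<open>K\<close> gives
        \<open>\<epsilon>\<^sup>2 * m n / 2 > ln n\<close>, that is,
        \<open>n * exp (- (\<epsilon>\<^sup>2 * m n / 2)) < 1\<close>.\<close>
      using large[of "2 / \<epsilon>\<^sup>2"]
    proof eventually_elim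
      case (elim n)
      then have n: "n \<ge> 2" "\<epsilon>\<^sup>2 * real (m n) / 2 > ln (real n)"
        using \<epsilon>(1) by (auto simp: field_simps)
      moreover have "ln (real n) > 0"
        using n by simp
      ultimately have m: "m n > 0"
        by (auto intro: gr0I)
      have "real n * exp (- (\<epsilon>\<^sup>2 * real (m n) / 2)) < real n * exp (- ln (real n))"
        using n by (intro mult_strict_left_mono) auto
      also have "\<dots> = 1"
        using n by (simp add: exp_minus)
      finally have "(?\<rho> - \<epsilon>) * real (m n) \<le> real (kappa r 2 (m n) n)"
        using assms(1) n \<epsilon> by (intro kappa_2_lower) auto
      moreover have "a * real (m n) < (?\<rho> - \<epsilon>) * real (m n)"
        using m \<epsilon>(3) by (intro mult_strict_right_mono) auto
      ultimately have "a * real (m n) < real (kappa r 2 (m n) n)"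
        by linarith
      then show ?case
        using m by (simp add: pos_less_divide_eq)
    qed
  next
    fix a assume "?\<rho> < a"
    \<comment> \<open>The Plotkin factor \<open>n / (n - 1)\<close> equals
      \<open>1 + 1 / (n - 1)\<close> and tends to 1.\<close>
    have "(\<lambda>n. ?\<rho> * (1 + 1 / (real n - 1))) \<longlonglongrightarrow> ?\<rho> * (1 + 0)"
      by (intro tendsto_intros tendsto_divide_0[OF tendsto_const] filterlim_at_top_imp_at_infinity
          filterlim_tendsto_add_at_top[OF tendsto_const[of "-1"] filterlim_real_sequentially, simplified])
    then have "eventually (\<lambda>n. ?\<rho> * (1 + 1 / (real n - 1)) < a) sequentially"
      using \<open>?\<rho> < a\<close> by (intro order_tendstoD) auto
    then show "eventually (\<lambda>n. real (kappa r 2 (m n) n) / real (m n) < a) sequentially"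
      \<comment> \<open>With \<open>K = 0\<close> this supplies \<open>m n > 0\<close>, needed to
        divide by \<open>m n\<close>.\<close>
      using large[of 0]
    proof eventually_elim
      case (elim n)
      then have m: "m n > 0" and n: "n \<ge> 2" by auto
      have "real (kappa r 2 (m n) n) \<le> ?\<rho> * real (m n) * (real n / (real n - 1))"
        using assms(1) n by (intro kappa_2_upper) auto
      also have "real n / (real n - 1) = 1 + 1 / (real n - 1)"
        using n by (simp add: field_simps)
      also have "?\<rho> * real (m n) * (1 + 1 / (real n - 1)) = ?\<rho> * (1 + 1 / (real n - 1)) * real (m n)"
        by (simp only: mult_ac)
      also have "\<dots> < a * real (m n)"
        using m elim by (intro mult_strict_right_mono) auto
      finally show ?case
        using m by (simp add: pos_divide_less_eq)
    qed
  qed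
qed

end
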